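(* Let $p<q$ be square-free integers $\ge 2$ with $p\equiv 2\pmod 4$ and $q\equiv 3\pmod 4$, put $r=pq/\gcd(p,q)^2$ and assume $p<q<r$. Let $K=\mathbb{Q}(\sqrt p,\sqrt q)$ and assume $\sqrt p+\sqrt q+1>\lceil\sqrt r\rceil$. Let $m,t_1,t_2,\kappa$ be positive integers with $m<\frac{r}{16\kappa\lceil\sqrt r\rceil}$. Put $$N_1=\max\{\lceil 2\sqrt q-\sqrt p\rceil,\ \lceil\sqrt r-\sqrt p\rceil\}-\sqrt p,\qquad N_2=\max\{\lceil 2\sqrt p-\sqrt q\rceil,\ \lceil\sqrt r-\sqrt q\rceil\}-\sqrt q ,$$ and for $j=1,2$ let $$I'_j=\left[\frac{m\kappa}{t_j}+\frac{\sqrt{2m\kappa N_j}}{\sqrt{t_j}},\ \frac{m\kappa}{t_j-1}-\frac{\sqrt{2m\kappa N_j}}{\sqrt{t_j-1}}\right]\ \text{ if } t_j>1,\qquad I'_j=\left[m\kappa+\sqrt{2m\kappa N_j},\ \infty\right)\ \text{ if } t_j=1.$$ If $\sqrt p\in I'_1$ and $\sqrt q\in I'_2$, then not all elements of $m\mathcal{O}_K^+$ are sums of squares of elements of $\mathcal{O}_K$. Moreover, the intervals $I'_1,I'_2$ are non-empty for $$m\ge\max\left\{\frac{2N_jt_j(t_j-1)\left(2t_j-1+2\sqrt{t_j(t_j-1)}\right)}{\kappa}\ :\ j=1,2\right\}.$$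
   Context: $\mathcal{O}_K$ is the ring of integers of $K$, $\mathcal{O}_K^+$ is the set of its totally positive elements (all four real embeddings positive), and $m\mathcal{O}_K^+=\{m\alpha:\alpha\in\mathcal{O}_K^+\}$. A sum of squares in $\mathcal{O}_K$ is a finite sum $\sum_i\alpha_i^2$ with $\alpha_i\in\mathcal{O}_K$. The square roots are real, so the definition of the intervals presupposes $N_1,N_2\ge0$. *)

theory Defs
  imports
    Complex_Main
    "HOL-Computational_Algebra.Computational_Algebra"
    "HOL-Algebra.Generated_Fields"
    "HOL-Algebra.Algebraic_Closure_Type"
begin

abbreviation real_ring :: "real ring" where
  "real_ring \<equiv> ring_of_type_algebra"

text \<open>The field generated by two real square roots, as a subset of the reals.\<close>

definition biquadratic_field :: "nat \<Rightarrow> nat \<Rightarrow> real set" where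
  "biquadratic_field p q = generate_field real_ring {sqrt (real p), sqrt (real q)}"

definition ring_of_integers :: "real set \<Rightarrow> real set" where
  "ring_of_integers K = {x \<in> K. algebraic_int x}"

text \<open>A ring homomorphism is only constrained on its domain, so two functions that agree on
  \<open>K\<close> represent the same embedding; this does not matter below, since embeddings are only
  evaluated at elements of \<open>K\<close>.\<close>

definition real_embeddings :: "real set \<Rightarrow> (real \<Rightarrow> real) set" where
  "real_embeddings K = ring_hom (real_ring \<lparr>carrier := K\<rparr>) real_ring"

definition totally_positive_integers :: "real set \<Rightarrow> real set" where
  "totally_positive_integers K =
     {x \<in> ring_of_integers K. \<forall>\<sigma> \<in> real_embeddings K. \<sigma> x > 0}"

definition sums_of_squares :: "real set \<Rightarrow> real set" where
  "sums_of_squares R = {(\<Sum>a\<leftarrow>as. a\<^sup>2) |as. set as \<subseteq> R}"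

text \<open>The intervals \<open>I'\<^sub>j\<close>, for \<open>t \<ge> 1\<close>. Isabelle's \<open>sqrt\<close> is total and odd, so the intended
  meaning presupposes \<open>N \<ge> 0\<close>.\<close>

definition interval_I' :: "nat \<Rightarrow> nat \<Rightarrow> real \<Rightarrow> nat \<Rightarrow> real set" where
  "interval_I' m \<kappa> N t =
     (if t > 1 then
        {real m * real \<kappa> / real t + sqrt (2 * real m * real \<kappa> * N) / sqrt (real t) ..
         real m * real \<kappa> / (real t - 1) - sqrt (2 * real m * real \<kappa> * N) / sqrt (real t - 1)}
      else {real m * real \<kappa> + sqrt (2 * real m * real \<kappa> * N) ..})"

end

theory Submission
  imports Defs
begin

text \<open>Put \<open>c = N1 + \<surd>p\<close>, an integer. The witness is \<open>\<alpha> = 2\<kappa>(c + \<surd>p)\<close>, which is totally positive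
  since \<open>c > \<surd>p\<close>. If \<open>m\<alpha>\<close> is a sum of squares of integers with coordinates \<open>e, f, h, k\<close> with
  respect to \<open>1, \<surd>p, \<surd>q, \<surd>p\<surd>q\<close>, then every \<open>k\<close> vanishes, because a nonzero one would contribute
  at least \<open>r/4 > 2m\<kappa>c\<close> to the rational part. For such integers \<open>f\<close> is a rational integer, so
  \<open>B = \<Sum>f\<^sup>2\<close> is a natural number. Comparing coefficients and applying Cauchy--Schwarz to
  \<open>\<Sum>ef = m\<kappa>\<close> gives \<open>pB\<^sup>2 + (m\<kappa>)\<^sup>2 \<le> 2m\<kappa>cB\<close>, that is,
  \<open>\<bar>\<surd>p - m\<kappa>/B\<bar> \<le> \<surd>(2m\<kappa>N1/B)\<close>. The interval for \<open>t1\<close> excludes this strictly inside; at its end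
  points equality would make \<open>c\<^sup>2 - p\<close> a square, which \<open>p \<equiv> 2 (mod 4)\<close> forbids.\<close>

subsection \<open>Rational square roots\<close>

lemma Rats_cases_coprime:
  fixes x :: real
  assumes "x \<in> \<rat>"
  obtains u v :: int where "v > 0" "coprime u v" "x = of_int u / of_int v"
  using assms by (cases rule: Rats_cases') auto

text \<open>For x = u/v in lowest terms, v^2 divides n u^2 and hence n, so v = 1. Below, n x^2
  arises from norms.\<close>

lemma Ints_if_squarefree_mult_square:
  fixes x :: real
  assumes "squarefree n" "x \<in> \<rat>" "real n * x\<^sup>2 \<in> \<int>"
  shows "x \<in> \<int>"
proof -
  obtain u v :: int where v: "v > 0" "coprime u v" and x: "x = of_int u / of_int v"
    using Rats_cases_coprime[OF assms(2)] .
  obtain k where "real n * x\<^sup>2 = of_int k"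
    using assms(3) by (elim Ints_cases)
  hence "real_of_int (int n * u\<^sup>2) = of_int (k * v\<^sup>2)"
    using v x by (simp add: field_simps)
  hence "int n * u\<^sup>2 = k * v\<^sup>2"
    by linarith
  hence "v\<^sup>2 dvd int n * u\<^sup>2"
    by simp
  hence "v\<^sup>2 dvd int n"
    using v by (metis coprime_commute coprime_dvd_mult_left_iff coprime_power_left_iff coprime_power_right_iff)
  hence "(nat v)\<^sup>2 dvd n"
    using v by (metis nat_dvd_iff nat_power_eq order_less_imp_le int_dvd_int_iff int_nat_eq of_nat_power)
  hence "nat v = 1"
    using assms(1) squarefreeD by fastforce
  hence "v = 1"
    using v by simp
  thus ?thesis
    using x by simp
qed

lemma sqrt_squarefree_irrational:
  assumes "squarefree n" "n \<ge> 2"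
  shows "sqrt (real n) \<notin> \<rat>"
proof
  assume "sqrt (real n) \<in> \<rat>"
  \<comment> \<open>The reciprocal is the useful number: n times its square is 1, so it would be an
    integer strictly between 0 and 1.\<close>
  hence "1 / sqrt (real n) \<in> \<rat>"
    by auto
  moreover have "real n * (1 / sqrt (real n))\<^sup>2 \<in> \<int>"
    using assms by (simp add: power_divide)
  ultimately have "1 / sqrt (real n) \<in> \<int>"
    using Ints_if_squarefree_mult_square assms by blast
  then obtain k where k: "1 / sqrt (real n) = of_int k"
    by (elim Ints_cases)
  have "1 < sqrt (real n)"
    using assms by simp
  hence "0 < 1 / sqrt (real n)" "1 / sqrt (real n) < 1"
    by (auto simp: field_simps)
  thus False
    using k by simp
qed

text \<open>All powers of the reduced denominator v divide the fixed D, which leaves only v =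
  1.\<close>

lemma rational_bounded_denominator_imp_Ints:
  fixes x :: real
  assumes "x \<in> \<rat>" "D > 0" "\<And>n. real D * x ^ n \<in> \<int>"
  shows "x \<in> \<int>"
proof -
  obtain u v :: int where v: "v > 0" "coprime u v" and x: "x = of_int u / of_int v"
    using Rats_cases_coprime[OF assms(1)] .
  have "v ^ n dvd int D" for n
  proof -
    obtain k where "real D * x ^ n = of_int k"
      using assms(3)[of n] by (elim Ints_cases)
    hence "real_of_int (int D * u ^ n) = of_int (k * v ^ n)"
      using v x by (simp add: field_simps)
    hence "int D * u ^ n = k * v ^ n"
      by linarith
    hence "v ^ n dvd int D * u ^ n"
      by simp
    thus ?thesis
      using v by (metis coprime_commute coprime_dvd_mult_left_iff coprime_power_left_iff coprime_power_right_iff)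
  qed
  \<comment> \<open>The exponent D suffices, because v >= 2 would give v^D >= 2^D > D.\<close>
  hence bound: "v ^ D \<le> int D"
    using assms(2) zdvd_imp_le by auto
  have "v = 1"
  proof (rule ccontr)
    assume "v \<noteq> 1"
    hence "v \<ge> 2"
      using v by simp
    hence "2 ^ D \<le> v ^ D"
      by (simp add: power_mono)
    moreover have "int D < 2 ^ D"
      using of_nat_less_two_power by blast
    ultimately show False
      using bound by simp
  qed
  thus ?thesis
    using x by simp
qed

text \<open>Modulo 2 the equation makes k even; then 4 divides p l^2, and p has only one factor
  2.\<close>

lemma even_if_4_dvd_diff_square:
  fixes k l :: int
  assumes "k\<^sup>2 - int p * l\<^sup>2 = 4 * j" "p mod 4 = 2"
  shows "even k" "even l"
proof -
  define i where "i = p div 4"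
  have p: "p = 4 * i + 2"
    using assms(2) unfolding i_def by presburger
  have "k\<^sup>2 = 2 * (2 * j + (2 * int i + 1) * l\<^sup>2)"
    using assms(1) p by (simp add: algebra_simps)
  hence "even (k\<^sup>2)"
    by simp
  thus "even k"
    by simp
  then obtain k' where "k = 2 * k'" ..
  hence "l\<^sup>2 = 2 * (k'\<^sup>2 - j - int i * l\<^sup>2)"
    using assms(1) p by (simp add: algebra_simps)
  hence "even (l\<^sup>2)"
    by (rule dvdI)
  thus "even l"
    by simp
qed

text \<open>Completing the square gives p = c^2 - (x - c)^2, where x - c is integral as a rational
  number with integral square. A difference of two integer squares is never 2 modulo 4.\<close>

lemma not_rational_root:
  fixes x c :: real
  assumes "p mod 4 = 2" "x \<in> \<rat>" "c \<in> \<int>"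
  shows "real p + x\<^sup>2 \<noteq> 2 * x * c"
proof
  assume "real p + x\<^sup>2 = 2 * x * c"
  hence eq: "(x - c)\<^sup>2 = c\<^sup>2 - real p"
    by (simp add: power2_eq_square algebra_simps)
  have "x - c \<in> \<rat>"
    using assms Ints_subset_Rats by (intro Rats_diff) auto
  moreover have "real 1 * (x - c)\<^sup>2 \<in> \<int>"
    using assms eq by simp
  ultimately have "x - c \<in> \<int>"
    by (rule Ints_if_squarefree_mult_square[OF squarefree_1])
  then obtain k where k: "x - c = of_int k"
    by (elim Ints_cases)
  obtain d where d: "c = of_int d"
    using assms by (elim Ints_cases)
  have "real_of_int (k\<^sup>2) = of_int (d\<^sup>2 - int p)"
    using eq k d by simp
  hence "int p = d\<^sup>2 - k\<^sup>2"
    by linarith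
  hence p: "int p = (d - k) * (d + k)"
    by (simp add: power2_eq_square algebra_simps)
  show False
  proof (cases "even (d - k)")
    case True
    then obtain e where "d - k = 2 * e" ..
    hence "d - k = 2 * e" "d + k = 2 * (e + k)"
      by auto
    hence "int p = 4 * (e * (e + k))"
      using p by simp
    hence "4 dvd int p"
      by (rule dvdI)
    thus False
      using assms(1) by presburger
  next
    case False
    hence "odd (d + k)"
      by simp
    hence "odd (int p)"
      unfolding p using False by simp
    thus False
      using assms(1) by presburger
  qed
qed

subsection \<open>Coordinates with respect to two square roots\<close>

text \<open>The roots \<open>s\<close> and \<open>t\<close> are parameters, so that a conjugate is
  the same expression with signs of the roots changed.\<close>

definition quad :: "real \<Rightarrow> real \<Rightarrow> real \<Rightarrow> real \<Rightarrow> real \<Rightarrow> real \<Rightarrow> real" where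
  "quad s t a b c d = a + b * s + c * t + d * (s * t)"

lemma quad_add: "quad s t a b c d + quad s t a' b' c' d' = quad s t (a + a') (b + b') (c + c') (d + d')"
  by (simp add: quad_def algebra_simps)

lemma quad_scale: "k * quad s t a b c d = quad s t (k * a) (k * b) (k * c) (k * d)"
  by (simp add: quad_def algebra_simps)

lemma quad_mult:
  assumes "s\<^sup>2 = P" "t\<^sup>2 = Q"
  shows "quad s t a b c d * quad s t a' b' c' d' =
    quad s t (a * a' + P * (b * b') + Q * (c * c') + P * Q * (d * d'))
      (a * b' + b * a' + Q * (c * d' + d * c'))
      (a * c' + c * a' + P * (b * d' + d * b'))
      (a * d' + d * a' + b * c' + c * b')"
  unfolding assms[symmetric] quad_def by (simp add: algebra_simps power2_eq_square)

text \<open>The coordinates of a power do not depend on the signs of the roots; this is how powers are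
  compared with powers of conjugates.\<close>

lemma quad_power:
  assumes "P \<in> \<rat>" "Q \<in> \<rat>" "a \<in> \<rat>" "b \<in> \<rat>" "c \<in> \<rat>" "d \<in> \<rat>"
  shows "\<exists>a'\<in>\<rat>. \<exists>b'\<in>\<rat>. \<exists>c'\<in>\<rat>. \<exists>d'\<in>\<rat>. \<forall>s t. s\<^sup>2 = P \<longrightarrow> t\<^sup>2 = Q \<longrightarrow>
    quad s t a b c d ^ n = quad s t a' b' c' d'"
proof (induction n)
  case 0
  show ?case
    by (intro bexI[of _ 1] bexI[of _ 0]) (auto simp: quad_def)
next
  case (Suc n)
  then obtain a' b' c' d' where r: "a' \<in> \<rat>" "b' \<in> \<rat>" "c' \<in> \<rat>" "d' \<in> \<rat>"
    and eq: "\<And>s t. s\<^sup>2 = P \<Longrightarrow> t\<^sup>2 = Q \<Longrightarrow> quad s t a b c d ^ n = quad s t a' b' c' d'"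
    by blast
  have *: "quad s t a b c d ^ Suc n = quad s t (a * a' + P * (b * b') + Q * (c * c') + P * Q * (d * d'))
      (a * b' + b * a' + Q * (c * d' + d * c')) (a * c' + c * a' + P * (b * d' + d * b'))
      (a * d' + d * a' + b * c' + c * b')" if "s\<^sup>2 = P" "t\<^sup>2 = Q" for s t
    using that by (simp only: power_Suc eq quad_mult)
  show ?case
    by (intro bexI allI impI, erule (1) *) (use assms r in \<open>auto intro!: Rats_add Rats_mult\<close>)
qed

section \<open>Linear independence of 1, sqrt(p), sqrt(q), sqrt(p) sqrt(q) over the
  rationals\<close>

locale biquadratic =
  fixes p q :: nat
  assumes irrational: "sqrt (real p) \<notin> \<rat>" "sqrt (real q) \<notin> \<rat>" "sqrt (real p) * sqrt (real q) \<notin> \<rat>"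
begin

abbreviation Quad :: "real \<Rightarrow> real \<Rightarrow> real \<Rightarrow> real \<Rightarrow> real" where
  "Quad \<equiv> quad (sqrt (real p)) (sqrt (real q))"

lemma linear_eq_0D:
  assumes "a \<in> \<rat>" "b \<in> \<rat>" "a + b * s = 0" "s \<notin> \<rat>"
  shows "a = 0" "(b :: real) = 0"
proof -
  have "b = 0"
  proof (rule ccontr)
    assume "b \<noteq> 0"
    hence "s = - a / b"
      using assms(3) by (simp add: field_simps)
    thus False
      using assms by auto
  qed
  thus "a = 0" "b = 0"
    using assms by auto
qed

text \<open>The relation is read as linear in t over Q(s). If the coefficient of t is nonzero, then
  t = e + f s; squaring forces e f = 0, so s t or t would be rational.\<close>

lemma Quad_eq_0D:
  assumes "a \<in> \<rat>" "b \<in> \<rat>" "c \<in> \<rat>" "d \<in> \<rat>" "Quad a b c d = 0"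
  shows "a = 0 \<and> b = 0 \<and> c = 0 \<and> d = 0"
proof -
  define s t where "s = sqrt (real p)" and "t = sqrt (real q)"
  have sq: "s\<^sup>2 = real p" "t\<^sup>2 = real q"
    by (auto simp: s_def t_def)
  have irr: "s \<notin> \<rat>" "t \<notin> \<rat>" "s * t \<notin> \<rat>"
    using irrational by (auto simp: s_def t_def)
  have eq: "(a + b * s) + (c + d * s) * t = 0"
    using assms(5) by (simp add: quad_def s_def t_def algebra_simps)
  show ?thesis
  proof (cases "c + d * s = 0")
    case True
    thus ?thesis
      using eq linear_eq_0D[of c d s] linear_eq_0D[of a b s] assms irr by auto
  next
    case False
    define n where "n = c\<^sup>2 - real p * d\<^sup>2"
    have n: "n = (c + d * s) * (c - d * s)"
      unfolding n_def sq(1)[symmetric] by (simp add: power2_eq_square algebra_simps)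
    have "c - d * s \<noteq> 0"
    proof
      assume "c - d * s = 0"
      hence "c = 0" "d = 0"
        using linear_eq_0D[of c "-d" s] assms irr by auto
      thus False
        using False by simp
    qed
    hence n0: "n \<noteq> 0"
      using False n by simp
    have nQ: "n \<in> \<rat>"
      unfolding n_def using assms by auto
    \<comment> \<open>These are the coordinates of -(a + b s) / (c + d s) after extending the
      fraction by c - d s.\<close>
    define e f where "e = (real p * b * d - a * c) / n" and "f = (a * d - b * c) / n"
    have efQ: "e \<in> \<rat>" "f \<in> \<rat>"
      unfolding e_def f_def using assms nQ by auto
    have "n * t = (c - d * s) * ((c + d * s) * t)"
      by (simp add: n)
    also have "(c + d * s) * t = - (a + b * s)"
      using eq by linarith
    also have "(c - d * s) * (- (a + b * s)) = (real p * b * d - a * c) + (a * d - b * c) * s"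
      unfolding sq(1)[symmetric] by (simp add: power2_eq_square algebra_simps)
    finally have t: "t = e + f * s"
      unfolding e_def f_def using n0 by (simp add: field_simps)
    have "real q = e\<^sup>2 + f\<^sup>2 * real p + 2 * e * f * s"
      unfolding sq[symmetric] unfolding t by (simp add: power2_eq_square algebra_simps)
    hence "(e\<^sup>2 + f\<^sup>2 * real p - real q) + (2 * e * f) * s = 0"
      by simp
    hence "2 * e * f = 0"
      using linear_eq_0D(2)[of "e\<^sup>2 + f\<^sup>2 * real p - real q" "2 * e * f" s] efQ irr by auto
    hence "e = 0 \<or> f = 0"
      by simp
    moreover have "s * t \<in> \<rat>" if "e = 0"
    proof -
      have "s * t = f * real p"
        unfolding sq[symmetric] t using that by (simp add: power2_eq_square)
      thus ?thesis
        using efQ by simp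
    qed
    moreover have "t \<in> \<rat>" if "f = 0"
      unfolding t using efQ that by simp
    ultimately have False
      using irr by metis
    thus ?thesis ..
  qed
qed

lemma Quad_inject:
  assumes "a \<in> \<rat>" "b \<in> \<rat>" "c \<in> \<rat>" "d \<in> \<rat>" "a' \<in> \<rat>" "b' \<in> \<rat>" "c' \<in> \<rat>" "d' \<in> \<rat>"
    and "Quad a b c d = Quad a' b' c' d'"
  shows "a = a' \<and> b = b' \<and> c = c' \<and> d = d'"
  using Quad_eq_0D[of "a - a'" "b - b'" "c - c'" "d - d'"] assms
  by (auto simp: quad_def algebra_simps)

section \<open>The rational span of the basis is closed under the field operations\<close>

definition span :: "real set" where
  "span = {Quad a b c d |a b c d. a \<in> \<rat> \<and> b \<in> \<rat> \<and> c \<in> \<rat> \<and> d \<in> \<rat>}"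

lemma span_I [intro]: "a \<in> \<rat> \<Longrightarrow> b \<in> \<rat> \<Longrightarrow> c \<in> \<rat> \<Longrightarrow> d \<in> \<rat> \<Longrightarrow> Quad a b c d \<in> span"
  by (auto simp: span_def)

lemma span_E:
  assumes "x \<in> span"
  obtains a b c d where "a \<in> \<rat>" "b \<in> \<rat>" "c \<in> \<rat>" "d \<in> \<rat>" "x = Quad a b c d"
  using assms by (auto simp: span_def)

lemma span_add: "x \<in> span \<Longrightarrow> y \<in> span \<Longrightarrow> x + y \<in> span"
  by (elim span_E) (auto simp: quad_add intro!: span_I Rats_add)

lemma span_mult: "x \<in> span \<Longrightarrow> y \<in> span \<Longrightarrow> x * y \<in> span"
  by (elim span_E) (auto simp: quad_mult[of _ "real p" _ "real q"] intro!: span_I Rats_add Rats_mult)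

lemma Rats_subset_span: "x \<in> \<rat> \<Longrightarrow> x \<in> span"
  using span_I[of x 0 0 0] by (simp add: quad_def)

lemma sqrt_in_span: "sqrt (real p) \<in> span" "sqrt (real q) \<in> span"
  using span_I[of 0 1 0 0] span_I[of 0 0 1 0] by (simp_all add: quad_def)

text \<open>The inverse is obtained by multiplying with the three conjugates and dividing by the
  rational norm.\<close>

lemma span_inverse:
  assumes "x \<in> span" "x \<noteq> 0"
  shows "inverse x \<in> span"
proof -
  obtain a b c d where r: "a \<in> \<rat>" "b \<in> \<rat>" "c \<in> \<rat>" "d \<in> \<rat>" and x: "x = Quad a b c d"
    using assms(1) by (elim span_E)
  \<comment> \<open>The conjugate that changes the sign of sqrt(q): x y lies in Q(sqrt(p)), and its
    own norm is n.\<close>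
  define y where "y = Quad a b (-c) (-d)"
  define u v where "u = a\<^sup>2 + real p * b\<^sup>2 - real q * c\<^sup>2 - real p * real q * d\<^sup>2"
    and "v = 2 * a * b - 2 * real q * c * d"
  have uv: "u \<in> \<rat>" "v \<in> \<rat>"
    using r by (auto simp: u_def v_def intro!: Rats_add Rats_diff)
  have "y \<noteq> 0"
  proof
    assume "y = 0"
    hence "a = 0 \<and> b = 0 \<and> - c = 0 \<and> - d = 0"
      unfolding y_def using r by (intro Quad_eq_0D) auto
    thus False
      using x assms(2) by (simp add: quad_def)
  qed
  have xy: "x * y = Quad u v 0 0"
    unfolding x y_def
    by (simp add: quad_mult[of _ "real p" _ "real q"] u_def v_def power2_eq_square algebra_simps)
  define n where "n = u\<^sup>2 - real p * v\<^sup>2"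
  have "Quad u (-v) 0 0 \<noteq> 0"
  proof
    assume "Quad u (-v) 0 0 = 0"
    hence "u = 0 \<and> - v = 0 \<and> (0::real) = 0 \<and> (0::real) = 0"
      using uv by (intro Quad_eq_0D) auto
    hence "x * y = 0"
      using xy by (simp add: quad_def)
    thus False
      using \<open>y \<noteq> 0\<close> assms(2) by simp
  qed
  moreover have n: "x * y * Quad u (-v) 0 0 = n"
    unfolding xy n_def
    by (subst quad_mult[of _ "real p" _ "real q"]) (auto simp: quad_def power2_eq_square algebra_simps)
  ultimately have "n \<noteq> 0"
    using \<open>y \<noteq> 0\<close> assms(2) by (metis mult_eq_0_iff)
  hence "x * (y * Quad u (-v) 0 0 * inverse n) = 1"
    using n by (metis mult.assoc right_inverse)
  hence "inverse x = y * Quad u (-v) 0 0 * inverse n"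
    by (rule inverse_unique)
  moreover have "n \<in> \<rat>"
    using uv by (auto simp: n_def intro!: Rats_diff)
  hence "inverse n \<in> span"
    by (intro Rats_subset_span) auto
  moreover have "y \<in> span" "Quad u (-v) 0 0 \<in> span"
    unfolding y_def using r uv by (auto intro!: span_I)
  ultimately show ?thesis
    by (simp add: span_mult)
qed

text \<open>This inclusion supplies the rational coordinates of field elements: the span contains
  the generators and is closed under every operation that builds the field.\<close>

lemma biquadratic_field_subset_span: "biquadratic_field p q \<subseteq> span"
proof
  interpret R: field real_ring
    by (rule field_from_type_algebra)
  have carrier: "y \<in> carrier real_ring" for y
    by (simp add: ring_of_type_algebra_def)
  fix x
  assume "x \<in> biquadratic_field p q"
  hence "x \<in> generate_field real_ring {sqrt (real p), sqrt (real q)}"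
    by (simp add: biquadratic_field_def)
  thus "x \<in> span"
  proof induction
    case one
    thus ?case
      by (simp add: ring_of_type_algebra_def Rats_subset_span)
  next
    case (incl h)
    thus ?case
      using sqrt_in_span by auto
  next
    case (a_inv h)
    have "\<ominus>\<^bsub>real_ring\<^esub> h = - h"
      by (rule R.minus_equality) (use carrier in \<open>auto simp: ring_of_type_algebra_def\<close>)
    thus ?case
      using span_mult[OF Rats_subset_span[of "-1"] a_inv.IH] by simp
  next
    case (m_inv h)
    hence "h \<noteq> 0"
      by (simp add: ring_of_type_algebra_def)
    moreover from this have "inv\<^bsub>real_ring\<^esub> h = inverse h"
      by (intro R.comm_inv_char carrier) (auto simp: ring_of_type_algebra_def)
    ultimately show ?case
      using span_inverse m_inv.IH by simp
  next
    case (eng_add h1 h2)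
    thus ?case
      by (auto simp: ring_of_type_algebra_def intro: span_add)
  next
    case (eng_mult h1 h2)
    thus ?case
      by (auto simp: ring_of_type_algebra_def intro: span_mult)
  qed
qed

subsection \<open>Algebraic integers have bounded denominators\<close>

text \<open>The order Z[sqrt(p), sqrt(q)]. It may be smaller than the ring of integers and is the
  reference against which denominators are bounded.\<close>

definition lattice :: "real set" where
  "lattice = {Quad a b c d |a b c d. a \<in> \<int> \<and> b \<in> \<int> \<and> c \<in> \<int> \<and> d \<in> \<int>}"

lemma lattice_I [intro]: "a \<in> \<int> \<Longrightarrow> b \<in> \<int> \<Longrightarrow> c \<in> \<int> \<Longrightarrow> d \<in> \<int> \<Longrightarrow> Quad a b c d \<in> lattice"
  by (auto simp: lattice_def)

lemma lattice_E:
  assumes "x \<in> lattice"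
  obtains a b c d where "a \<in> \<int>" "b \<in> \<int>" "c \<in> \<int>" "d \<in> \<int>" "x = Quad a b c d"
  using assms by (auto simp: lattice_def)

lemma lattice_add: "x \<in> lattice \<Longrightarrow> y \<in> lattice \<Longrightarrow> x + y \<in> lattice"
  by (elim lattice_E) (auto simp: quad_add intro!: lattice_I)

lemma lattice_mult: "x \<in> lattice \<Longrightarrow> y \<in> lattice \<Longrightarrow> x * y \<in> lattice"
  by (elim lattice_E) (auto simp: quad_mult[of _ "real p" _ "real q"] intro!: lattice_I)

lemma Ints_subset_lattice: "x \<in> \<int> \<Longrightarrow> x \<in> lattice"
  using lattice_I[of x 0 0 0] by (simp add: quad_def)

lemma lattice_sum: "(\<And>i. i \<in> A \<Longrightarrow> f i \<in> lattice) \<Longrightarrow> sum f A \<in> lattice"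
  by (induction A rule: infinite_finite_induct) (auto intro: lattice_add Ints_subset_lattice)

lemma Quad_in_lattice_iff:
  assumes "a \<in> \<rat>" "b \<in> \<rat>" "c \<in> \<rat>" "d \<in> \<rat>"
  shows "Quad a b c d \<in> lattice \<longleftrightarrow> a \<in> \<int> \<and> b \<in> \<int> \<and> c \<in> \<int> \<and> d \<in> \<int>"
proof
  assume "Quad a b c d \<in> lattice"
  then obtain a' b' c' d' where i: "a' \<in> \<int>" "b' \<in> \<int>" "c' \<in> \<int>" "d' \<in> \<int>"
    and eq: "Quad a b c d = Quad a' b' c' d'"
    by (elim lattice_E)
  have "a = a' \<and> b = b' \<and> c = c' \<and> d = d'"
    using i Ints_subset_Rats by (intro Quad_inject eq assms) auto
  thus "a \<in> \<int> \<and> b \<in> \<int> \<and> c \<in> \<int> \<and> d \<in> \<int>"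
    using i by simp
qed auto

lemma Rats_clear_denominator:
  fixes x :: real
  assumes "x \<in> \<rat>"
  obtains D :: nat where "D > 0" "real D * x \<in> \<int>"
proof -
  obtain u v :: int where v: "v > 0" and x: "x = of_int u / of_int v"
    using Rats_cases_coprime[OF assms] .
  have "real (nat v) * x = of_int u"
    using v x by simp
  thus ?thesis
    using that[of "nat v"] v by simp
qed

lemma span_clear_denominator:
  assumes "x \<in> span"
  obtains D :: nat where "D > 0" "real D * x \<in> lattice"
proof -
  obtain a b c d where r: "a \<in> \<rat>" "b \<in> \<rat>" "c \<in> \<rat>" "d \<in> \<rat>" and x: "x = Quad a b c d"
    using assms by (elim span_E)
  obtain A where A: "A > 0" "real A * a \<in> \<int>" using Rats_clear_denominator[OF r(1)] .
  obtain B where B: "B > 0" "real B * b \<in> \<int>" using Rats_clear_denominator[OF r(2)] .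
  obtain C where C: "C > 0" "real C * c \<in> \<int>" using Rats_clear_denominator[OF r(3)] .
  obtain D where D: "D > 0" "real D * d \<in> \<int>" using Rats_clear_denominator[OF r(4)] .
  have "real (A * B * C * D) * x = Quad (real (B * C * D) * (real A * a)) (real (A * C * D) * (real B * b))
      (real (A * B * D) * (real C * c)) (real (A * B * C) * (real D * d))"
    unfolding x quad_scale by (simp add: mult_ac)
  also have "\<dots> \<in> lattice"
    by (rule lattice_I; rule Ints_mult[OF Ints_of_nat]; use A B C D in simp)
  finally show ?thesis
    using that[of "A * B * C * D"] A B C D by simp
qed

text \<open>Over a finitely generated ring this is equivalent to integrality. Unlike the latter it is
  evidently preserved by sums, products and conjugation.\<close>

definition almost_integral :: "real \<Rightarrow> bool" where
  "almost_integral x \<longleftrightarrow> (\<exists>D>0. \<forall>n. real D * x ^ n \<in> lattice)"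

lemma almost_integral_add:
  assumes "almost_integral x" "almost_integral y"
  shows "almost_integral (x + y)"
proof -
  obtain D where D: "D > 0" "\<And>n. real D * x ^ n \<in> lattice"
    using assms(1) by (auto simp: almost_integral_def)
  obtain E where E: "E > 0" "\<And>n. real E * y ^ n \<in> lattice"
    using assms(2) by (auto simp: almost_integral_def)
  have "real (D * E) * (x + y) ^ n \<in> lattice" for n
  proof -
    have "real (D * E) * (x + y) ^ n =
        (\<Sum>k\<le>n. real (n choose k) * ((real D * x ^ k) * (real E * y ^ (n - k))))"
      by (simp add: binomial_ring sum_distrib_left mult_ac)
    also have "\<dots> \<in> lattice"
      by (intro lattice_sum lattice_mult D E Ints_subset_lattice) auto
    finally show ?thesis .
  qed
  thus ?thesis
    unfolding almost_integral_def using D E by (intro exI[of _ "D * E"]) auto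
qed

lemma almost_integral_mult:
  assumes "almost_integral x" "almost_integral y"
  shows "almost_integral (x * y)"
proof -
  obtain D where D: "D > 0" "\<And>n. real D * x ^ n \<in> lattice"
    using assms(1) by (auto simp: almost_integral_def)
  obtain E where E: "E > 0" "\<And>n. real E * y ^ n \<in> lattice"
    using assms(2) by (auto simp: almost_integral_def)
  have "real (D * E) * (x * y) ^ n \<in> lattice" for n
    using lattice_mult[OF D(2)[of n] E(2)[of n]] by (simp add: power_mult_distrib mult_ac)
  thus ?thesis
    unfolding almost_integral_def using D E by (intro exI[of _ "D * E"]) auto
qed

lemma almost_integral_Rats_imp_Ints:
  assumes "almost_integral x" "x \<in> \<rat>"
  shows "x \<in> \<int>"
proof -
  obtain D where D: "D > 0" "\<And>n. real D * x ^ n \<in> lattice"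
    using assms(1) by (auto simp: almost_integral_def)
  have "real D * x ^ n \<in> \<int>" for n
    using D(2)[of n] Quad_in_lattice_iff[of "real D * x ^ n" 0 0 0] assms(2) by (auto simp: quad_def)
  thus ?thesis
    using rational_bounded_denominator_imp_Ints assms(2) D(1) by blast
qed

text \<open>By \<open>quad_power\<close>, conjugation only changes signs of the coordinates of each
  power, and the lattice is stable under such changes, so the same D works.\<close>

lemma almost_integral_conjugate:
  assumes "a \<in> \<rat>" "b \<in> \<rat>" "c \<in> \<rat>" "d \<in> \<rat>" "almost_integral (Quad a b c d)"
    and "\<epsilon> \<in> {1, -1}" "\<delta> \<in> {1, -1}"
  shows "almost_integral (Quad a (\<epsilon> * b) (\<delta> * c) (\<epsilon> * \<delta> * d))"
proof -
  obtain D where D: "D > 0" "\<And>n. real D * Quad a b c d ^ n \<in> lattice"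
    using assms(5) by (auto simp: almost_integral_def)
  have "real D * Quad a (\<epsilon> * b) (\<delta> * c) (\<epsilon> * \<delta> * d) ^ n \<in> lattice" for n
  proof -
    obtain a' b' c' d' where r: "a' \<in> \<rat>" "b' \<in> \<rat>" "c' \<in> \<rat>" "d' \<in> \<rat>"
      and eq: "\<And>s t. s\<^sup>2 = real p \<Longrightarrow> t\<^sup>2 = real q \<Longrightarrow> quad s t a b c d ^ n = quad s t a' b' c' d'"
      using quad_power[of "real p" "real q" a b c d n] assms by auto
    have flip: "Quad x (\<epsilon> * y) (\<delta> * z) (\<epsilon> * \<delta> * w) = quad (\<epsilon> * sqrt (real p)) (\<delta> * sqrt (real q)) x y z w"
      for x y z w
      by (simp add: quad_def mult_ac)
    have sq: "\<epsilon>\<^sup>2 = 1" "\<delta>\<^sup>2 = 1"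
      using assms by auto
    have "Quad a (\<epsilon> * b) (\<delta> * c) (\<epsilon> * \<delta> * d) ^ n = Quad a' (\<epsilon> * b') (\<delta> * c') (\<epsilon> * \<delta> * d')"
      unfolding flip by (rule eq) (auto simp: power_mult_distrib sq)
    moreover have "Quad (real D * a') (real D * b') (real D * c') (real D * d') \<in> lattice"
      using D(2)[of n] eq[of "sqrt (real p)" "sqrt (real q)"] by (simp add: quad_scale)
    hence "real D * a' \<in> \<int> \<and> real D * b' \<in> \<int> \<and> real D * c' \<in> \<int> \<and> real D * d' \<in> \<int>"
      using r by (subst (asm) Quad_in_lattice_iff) auto
    moreover have "\<epsilon> \<in> \<int>" "\<delta> \<in> \<int>"
      using assms by auto
    hence "Quad (real D * a') (\<epsilon> * (real D * b')) (\<delta> * (real D * c')) (\<epsilon> * \<delta> * (real D * d')) \<in> lattice"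
      using calculation by (intro lattice_I) (blast intro: Ints_mult)+
    ultimately show ?thesis
      by (simp add: quad_scale mult_ac)
  qed
  thus ?thesis
    using D(1) by (auto simp: almost_integral_def)
qed

lemma span_power: "x \<in> span \<Longrightarrow> x ^ n \<in> span"
  by (induction n) (auto intro: span_mult Rats_subset_span)

text \<open>One E clears the powers below the degree N of a monic integer polynomial; the recurrence
  given by that polynomial extends this to all higher powers.\<close>

lemma algebraic_int_imp_almost_integral:
  assumes "algebraic_int x" "x \<in> span"
  shows "almost_integral x"
proof -
  obtain f :: "real poly" where f: "\<And>i. coeff f i \<in> \<int>" "lead_coeff f = 1" "poly f x = 0"
    using assms(1) by (auto elim!: algebraic_int.cases)
  define N where "N = degree f"
  have "\<exists>D::nat. D > 0 \<and> real D * x ^ k \<in> lattice" for k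
    using span_clear_denominator[OF span_power[OF assms(2), of k]] by metis
  then obtain D :: "nat \<Rightarrow> nat" where D: "\<And>k. D k > 0" "\<And>k. real (D k) * x ^ k \<in> lattice"
    by metis
  define E where "E = (\<Prod>k<N. D k)"
  have "E > 0"
    unfolding E_def by (rule prod_pos) (use D in auto)
  moreover have "real E * x ^ n \<in> lattice" for n
  proof (induction n rule: less_induct)
    case (less n)
    show ?case
    proof (cases "n < N")
      case True
      hence "D n dvd E"
        unfolding E_def by (intro dvd_prodI) auto
      then obtain e where "E = D n * e" ..
      hence "real E * x ^ n = real e * (real (D n) * x ^ n)"
        by simp
      thus ?thesis
        using D(2) by (metis Ints_of_nat Ints_subset_lattice lattice_mult)
    next
      case False
      have "0 = (\<Sum>i\<le>N. coeff f i * x ^ i)"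
        using f(3) by (simp add: poly_altdef N_def)
      also have "{..N} = insert N {..<N}"
        by auto
      finally have "x ^ N = - (\<Sum>i<N. coeff f i * x ^ i)"
        using f(2) by (simp add: N_def)
      moreover have "x ^ n = x ^ (n - N) * x ^ N"
        using False by (simp flip: power_add)
      ultimately have "real E * x ^ n = (\<Sum>i<N. - coeff f i * (real E * x ^ (n - N + i)))"
        by (simp add: sum_distrib_left sum_negf power_add mult_ac)
      also have "\<dots> \<in> lattice"
        using False f(1) by (intro lattice_sum lattice_mult[OF Ints_subset_lattice] less) auto
      finally show ?thesis .
    qed
  qed
  ultimately show ?thesis
    by (auto simp: almost_integral_def)
qed

text \<open>The integers of Q(sqrt(p)) are Z[sqrt(p)] when p = 2 modulo 4. Trace and norm make 2u
  and 2v integers k and l such that 4 divides k^2 - p l^2, so both are even.\<close>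

lemma almost_integral_linear:
  assumes "u \<in> \<rat>" "v \<in> \<rat>" "almost_integral (Quad u v 0 0)" "squarefree p" "p mod 4 = 2"
  shows "u \<in> \<int>" "v \<in> \<int>"
proof -
  have conj: "almost_integral (Quad u (-v) 0 0)"
    using almost_integral_conjugate[of u v 0 0 "-1" 1] assms by simp
  have "almost_integral (2 * u)"
    using almost_integral_add[OF assms(3) conj] by (simp add: quad_add) (simp add: quad_def)
  hence "2 * u \<in> \<int>"
    using assms by (intro almost_integral_Rats_imp_Ints) auto
  then obtain k where k: "2 * u = of_int k"
    by (elim Ints_cases)
  have "Quad u v 0 0 * Quad u (-v) 0 0 = u\<^sup>2 - real p * v\<^sup>2"
    by (subst quad_mult[of _ "real p" _ "real q"]) (auto simp: quad_def power2_eq_square)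
  hence "almost_integral (u\<^sup>2 - real p * v\<^sup>2)"
    using almost_integral_mult[OF assms(3) conj] by simp
  hence "u\<^sup>2 - real p * v\<^sup>2 \<in> \<int>"
    using assms by (intro almost_integral_Rats_imp_Ints Rats_diff Rats_mult Rats_power) auto
  then obtain j where j: "u\<^sup>2 - real p * v\<^sup>2 = of_int j"
    by (elim Ints_cases)
  have eq: "real p * (2 * v)\<^sup>2 = (2 * u)\<^sup>2 - 4 * of_int j"
    using j by (simp add: power_mult_distrib)
  hence "real p * (2 * v)\<^sup>2 \<in> \<int>"
    unfolding eq k by auto
  hence "2 * v \<in> \<int>"
    by (rule Ints_if_squarefree_mult_square[OF assms(4), rotated]) (use assms in auto)
  then obtain l where l: "2 * v = of_int l"
    by (elim Ints_cases)
  have "real_of_int (k\<^sup>2 - int p * l\<^sup>2) = of_int (4 * j)"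
    using eq unfolding k l by simp
  hence "k\<^sup>2 - int p * l\<^sup>2 = 4 * j"
    by linarith
  hence "even k" "even l"
    using even_if_4_dvd_diff_square assms(5) by blast+
  then obtain k' l' where "k = 2 * k'" "l = 2 * l'"
    by (auto elim!: evenE)
  hence "u = of_int k'" "v = of_int l'"
    using k l by auto
  thus "u \<in> \<int>" "v \<in> \<int>"
    by auto
qed

text \<open>Since sqrt(p) sqrt(q) = g sqrt(r), the coefficient at sqrt(r) is g d. Sums of two
  conjugates are traces to the three quadratic subfields, and norms from there show that the doubled
  coefficients are integers.\<close>

lemma algebraic_int_coords:
  assumes "a \<in> \<rat>" "b \<in> \<rat>" "c \<in> \<rat>" "d \<in> \<rat>" "algebraic_int (Quad a b c d)"
    and p: "squarefree p" "p mod 4 = 2" and q: "squarefree q" "odd q"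
    and r: "p * q = r * g\<^sup>2" "squarefree r"
  shows "2 * (real g * d) \<in> \<int>" "d = 0 \<Longrightarrow> b \<in> \<int>"
proof -
  note rats = assms(1-4)
  have ai: "almost_integral (Quad a b c d)"
    using assms by (intro algebraic_int_imp_almost_integral) auto
  have ai1: "almost_integral (Quad a b (-c) (-d))"
    using almost_integral_conjugate[of a b c d 1 "-1"] ai rats by simp
  have ai2: "almost_integral (Quad a (-b) c (-d))"
    using almost_integral_conjugate[of a b c d "-1" 1] ai rats by simp
  have ai3: "almost_integral (Quad a (-b) (-c) d)"
    using almost_integral_conjugate[of a b c d "-1" "-1"] ai rats by simp
  have "almost_integral (Quad (2 * a) (2 * b) 0 0)"
    using almost_integral_add[OF ai ai1] by (simp add: quad_add)
  hence ab: "2 * a \<in> \<int>" "2 * b \<in> \<int>"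
    using rats p by (auto intro: almost_integral_linear[of "2 * a" "2 * b"])

  have aic: "almost_integral (Quad (2 * a) 0 (2 * c) 0)"
    using almost_integral_add[OF ai ai2] by (simp add: quad_add)
  moreover have aic': "almost_integral (Quad (2 * a) 0 (- (2 * c)) 0)"
    using almost_integral_add[OF ai1 ai3] by (simp add: quad_add)
  moreover have "Quad (2 * a) 0 (2 * c) 0 * Quad (2 * a) 0 (- (2 * c)) 0 = (2 * a)\<^sup>2 - real q * (2 * c)\<^sup>2"
    by (subst quad_mult[of _ "real p" _ "real q"]) (auto simp: quad_def power2_eq_square)
  ultimately have "almost_integral ((2 * a)\<^sup>2 - real q * (2 * c)\<^sup>2)"
    using almost_integral_mult by metis
  hence "(2 * a)\<^sup>2 - real q * (2 * c)\<^sup>2 \<in> \<int>"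
    using rats by (intro almost_integral_Rats_imp_Ints Rats_diff Rats_mult Rats_power) auto
  hence "(2 * a)\<^sup>2 - ((2 * a)\<^sup>2 - real q * (2 * c)\<^sup>2) \<in> \<int>"
    by (rule Ints_diff[OF Ints_power[OF ab(1)]])
  hence "real q * (2 * c)\<^sup>2 \<in> \<int>"
    by simp
  hence cI: "2 * c \<in> \<int>"
    by (rule Ints_if_squarefree_mult_square[OF q(1), rotated]) (use rats in auto)

  have aid: "almost_integral (Quad (2 * a) 0 0 (2 * d))"
    using almost_integral_add[OF ai ai3] by (simp add: quad_add)
  moreover have aid': "almost_integral (Quad (2 * a) 0 0 (- (2 * d)))"
    using almost_integral_add[OF ai1 ai2] by (simp add: quad_add)
  moreover have "Quad (2 * a) 0 0 (2 * d) * Quad (2 * a) 0 0 (- (2 * d)) =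
      (2 * a)\<^sup>2 - real p * real q * (2 * d)\<^sup>2"
    by (subst quad_mult[of _ "real p" _ "real q"]) (auto simp: quad_def power2_eq_square)
  moreover have "real p * real q * (2 * d)\<^sup>2 = real r * (2 * (real g * d))\<^sup>2"
  proof -
    have "real p * real q = real r * (real g)\<^sup>2"
      using r(1) by (metis of_nat_mult of_nat_power)
    thus ?thesis
      by (simp add: power_mult_distrib)
  qed
  ultimately have "almost_integral ((2 * a)\<^sup>2 - real r * (2 * (real g * d))\<^sup>2)"
    using almost_integral_mult by metis
  hence "(2 * a)\<^sup>2 - real r * (2 * (real g * d))\<^sup>2 \<in> \<int>"
    using rats by (intro almost_integral_Rats_imp_Ints Rats_diff Rats_mult Rats_power) auto
  hence "(2 * a)\<^sup>2 - ((2 * a)\<^sup>2 - real r * (2 * (real g * d))\<^sup>2) \<in> \<int>"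
    by (rule Ints_diff[OF Ints_power[OF ab(1)]])
  hence "real r * (2 * (real g * d))\<^sup>2 \<in> \<int>"
    by simp
  thus "2 * (real g * d) \<in> \<int>"
    by (rule Ints_if_squarefree_mult_square[OF r(2), rotated]) (use rats in auto)

  assume d: "d = 0"
  \<comment> \<open>With d = 0 this is the norm to Q(sqrt(p)), whose coordinates are integers by
    \<open>almost_integral_linear\<close>.\<close>
  have "Quad a b c d * Quad a b (-c) (-d) = Quad (a\<^sup>2 + real p * b\<^sup>2 - real q * c\<^sup>2) (2 * a * b) 0 0"
    by (simp add: d quad_mult[of _ "real p" _ "real q"] power2_eq_square algebra_simps)
  hence "almost_integral (Quad (a\<^sup>2 + real p * b\<^sup>2 - real q * c\<^sup>2) (2 * a * b) 0 0)"
    using almost_integral_mult[OF ai ai1] by simp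
  moreover have "a\<^sup>2 + real p * b\<^sup>2 - real q * c\<^sup>2 \<in> \<rat>" "2 * a * b \<in> \<rat>"
    using rats by (auto intro!: Rats_diff Rats_add)
  ultimately have norm: "a\<^sup>2 + real p * b\<^sup>2 - real q * c\<^sup>2 \<in> \<int>" "2 * a * b \<in> \<int>"
    using almost_integral_linear p by blast+
  obtain A B C j h where A: "2 * a = of_int A" and B: "2 * b = of_int B" and C: "2 * c = of_int C"
    and j: "a\<^sup>2 + real p * b\<^sup>2 - real q * c\<^sup>2 = of_int j" and h: "2 * a * b = of_int h"
    using ab cI norm by (meson Ints_cases)
  have "(2 * a) * (2 * b) = 2 * of_int h"
    using h by simp
  hence "real_of_int (A * B) = of_int (2 * h)"
    unfolding A B by simp
  hence AB: "A * B = 2 * h"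
    by linarith
  have "(2 * a)\<^sup>2 + real p * (2 * b)\<^sup>2 - real q * (2 * c)\<^sup>2 = 4 * of_int j"
    unfolding j[symmetric] by (simp add: power_mult_distrib algebra_simps)
  hence "real_of_int (A\<^sup>2 + int p * B\<^sup>2 - int q * C\<^sup>2) = of_int (4 * j)"
    unfolding A B C by simp
  hence eq: "A\<^sup>2 + int p * B\<^sup>2 - int q * C\<^sup>2 = 4 * j"
    by linarith
  \<comment> \<open>For odd B, the relation A B = 2h makes A even; as p is even and q odd, C is even
    too. Then 4 divides p B^2, which is impossible.\<close>
  have "even B"
  proof (rule ccontr)
    assume B: "odd B"
    have "even (A * B)"
      using AB by simp
    hence "even A"
      using B by simp
    then obtain A' where A': "A = 2 * A'" ..
    have "int q * C\<^sup>2 = A\<^sup>2 + int p * B\<^sup>2 - 4 * j"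
      using eq by simp
    moreover have "even p"
      using p(2) by presburger
    ultimately have "even (int q * C\<^sup>2)"
      using \<open>even A\<close> by simp
    hence "even C"
      using q by simp
    then obtain C' where C': "C = 2 * C'" ..
    have "0\<^sup>2 - int p * B\<^sup>2 = 4 * (A'\<^sup>2 - int q * C'\<^sup>2 - j)"
      using eq unfolding A' C' by (simp add: power_mult_distrib algebra_simps)
    thus False
      using even_if_4_dvd_diff_square(2) p(2) B by blast
  qed
  then obtain B' where "B = 2 * B'" ..
  hence "b = of_int B'"
    using B by simp
  thus "b \<in> \<int>"
    by simp
qed

end

subsection \<open>The intervals\<close>

text \<open>The inequality in B confines s to the neighbourhood of M/B of radius sqrt(2MN/B). Up to
  end points, the interval for t lies above these neighbourhoods when B >= t and below them when B
  <= t - 1.\<close>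

lemma not_in_interval_I':
  fixes m \<kappa> B t p :: nat and c :: real
  assumes pos: "m > 0" "\<kappa> > 0" "B > 0" "t > 0" and p: "p mod 4 = 2" and c: "c \<in> \<int>" "sqrt (real p) \<le> c"
    and B: "real p * (real B)\<^sup>2 + (real m * real \<kappa>)\<^sup>2 \<le> 2 * (real m * real \<kappa>) * c * real B"
  shows "sqrt (real p) \<notin> interval_I' m \<kappa> (c - sqrt (real p)) t"
proof
  assume mem: "sqrt (real p) \<in> interval_I' m \<kappa> (c - sqrt (real p)) t"
  define M s N where "M = real m * real \<kappa>" and "s = sqrt (real p)" and "N = c - s"
  have M: "M > 0" and N: "N \<ge> 0" and s2: "s\<^sup>2 = real p"
    using pos c by (auto simp: M_def s_def N_def)
  \<comment> \<open>With x = M/T, equality would give p + x^2 = 2 x c, which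
    \<open>not_rational_root\<close> excludes.\<close>
  have boundary: "(s - M / real T)\<^sup>2 \<noteq> 2 * M * N / real T" if "T > 0" for T
  proof
    assume "(s - M / real T)\<^sup>2 = 2 * M * N / real T"
    hence "real p + (M / real T)\<^sup>2 = 2 * (M / real T) * c"
      unfolding s2[symmetric] N_def using that by (simp add: power2_eq_square field_simps)
    moreover have "M / real T \<in> \<rat>"
      by (auto simp: M_def)
    ultimately show False
      using not_rational_root p c(1) by blast
  qed
  have "(s - M / real B)\<^sup>2 = (real p * (real B)\<^sup>2 + M\<^sup>2 - 2 * M * s * real B) / (real B)\<^sup>2"
    unfolding s2[symmetric] using pos by (simp add: power2_eq_square field_simps)
  also have "\<dots> \<le> (2 * M * N * real B) / (real B)\<^sup>2"
    using B[folded M_def] by (intro divide_right_mono) (auto simp: N_def algebra_simps)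
  also have "\<dots> = 2 * M * N / real B"
    using pos by (simp add: power2_eq_square)
  finally have "\<bar>s - M / real B\<bar> \<le> sqrt (2 * M * N / real B)"
    by (metis real_sqrt_abs real_sqrt_le_iff)
  hence upper: "s \<le> M / real B + sqrt (2 * M * N / real B)"
    and lower: "M / real B - sqrt (2 * M * N / real B) \<le> s"
    by (auto simp: abs_le_iff)
  show False
  \<comment> \<open>For t = 1 only the first case occurs, which fits the unbounded interval.\<close>
  proof (cases "B \<ge> t")
    case True
    have "M / real t + sqrt (2 * M * N / real t) \<le> s"
      using mem pos
      by (cases "t = 1") (auto simp: interval_I'_def M_def s_def N_def real_sqrt_divide mult.assoc split: if_splits)
    moreover have "M / real B + sqrt (2 * M * N / real B) \<le> M / real t + sqrt (2 * M * N / real t)"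
      using True M N pos by (intro add_mono real_sqrt_le_mono divide_left_mono) auto
    ultimately have "s - M / real t = sqrt (2 * M * N / real t)"
      using upper by linarith
    thus False
      using boundary[OF pos(4)] M N by simp
  next
    case False
    define T where "T = t - 1"
    have T: "B \<le> T" "T > 0" "real T = real t - 1"
      using False pos by (auto simp: T_def)
    have le: "s \<le> M / real T - sqrt (2 * M * N / real T)"
      using mem False pos
      by (auto simp: interval_I'_def M_def s_def N_def T(3) real_sqrt_divide mult.assoc split: if_splits)
    \<comment> \<open>M/B - sqrt(2MN/B) need not be monotone in B. Passing from T to B multiplies
      its two terms by \<rho> and sqrt(\<rho>); since the difference at T is at least s and hence
      nonnegative, it does not decrease.\<close>
    define \<rho> where "\<rho> = real T / real B"
    have \<rho>: "\<rho> \<ge> 1"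
      using T pos by (simp add: \<rho>_def)
    have "M / real T - sqrt (2 * M * N / real T) \<ge> 0"
      using le by (smt (verit) real_sqrt_ge_zero of_nat_0_le_iff s_def)
    moreover have "sqrt \<rho> \<ge> 1"
      using \<rho> by simp
    ultimately have "M / real T - sqrt (2 * M * N / real T)
        \<le> sqrt \<rho> * (M / real T - sqrt (2 * M * N / real T))"
      by (metis mult_right_mono mult_1)
    also have "\<dots> \<le> sqrt \<rho> * (sqrt \<rho> * (M / real T) - sqrt (2 * M * N / real T))"
    proof -
      have "1 * (M / real T) \<le> sqrt \<rho> * (M / real T)"
        using \<open>sqrt \<rho> \<ge> 1\<close> M by (intro mult_right_mono) auto
      thus ?thesis
        using \<rho> by (intro mult_left_mono) auto
    qed
    also have "\<dots> = \<rho> * (M / real T) - sqrt (\<rho> * (2 * M * N / real T))"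
      by (simp only: real_sqrt_mult right_diff_distrib) (use \<rho> in \<open>simp flip: mult.assoc\<close>)
    also have "\<dots> = M / real B - sqrt (2 * M * N / real B)"
      using T by (simp add: \<rho>_def)
    finally have "s = M / real T - sqrt (2 * M * N / real T)"
      using le lower by linarith
    hence "s - M / real T = - sqrt (2 * M * N / real T)"
      by simp
    thus False
      using boundary[OF T(2)] M N by simp
  qed
qed

text \<open>For t > 1 let a, b be the roots of t and t - 1. The end points are in order if sqrt(2MN)
  (1/a + 1/b) <= M (1/b^2 - 1/a^2). As a^2 - b^2 = 1, this is 2N (a b (a + b))^2 <= M, and (a + b)^2
  is the last factor of the bound on m.\<close>

lemma interval_I'_nonempty:
  assumes "m > 0" "\<kappa> > 0" "t > 0" "N \<ge> 0"
    and m: "2 * N * real t * (real t - 1) * (2 * real t - 1 + 2 * sqrt (real t * (real t - 1))) / real \<kappa> \<le> real m"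
  shows "interval_I' m \<kappa> N t \<noteq> {}"
proof (cases "t > 1")
  case False
  thus ?thesis
    by (auto simp: interval_I'_def intro: exI[of _ "real m * real \<kappa> + sqrt (2 * real m * real \<kappa> * N)"])
next
  case True
  define M a b where "M = real m * real \<kappa>" and "a = sqrt (real t)" and "b = sqrt (real t - 1)"
  have pos: "M > 0" "a > 0" "b > 0" and sq: "a\<^sup>2 = real t" "b\<^sup>2 = real t - 1"
    using assms True by (auto simp: M_def a_def b_def)
  have diff: "a\<^sup>2 - b\<^sup>2 = 1"
    using sq by simp
  have split: "y * (a * b * (a + b)) / (a\<^sup>2 * b\<^sup>2) = y / a + y / b" for y
  proof -
    have "y * (a * b * (a + b)) / (a\<^sup>2 * b\<^sup>2) = y * (a + b) / (a * b)"
      using pos by (simp add: power2_eq_square)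
    also have "y * (a + b) / (a * b) = y / a + y / b"
      using pos by (simp add: add_divide_distrib distrib_left)
    finally show ?thesis .
  qed
  have "2 * N * real t * (real t - 1) * (2 * real t - 1 + 2 * sqrt (real t * (real t - 1))) \<le> M"
    using m assms by (simp add: M_def field_simps)
  also have "2 * real t - 1 + 2 * sqrt (real t * (real t - 1)) = (a + b)\<^sup>2"
    using sq by (simp add: power2_sum a_def b_def real_sqrt_mult)
  also have "2 * N * real t * (real t - 1) * (a + b)\<^sup>2 = 2 * N * (a * b * (a + b))\<^sup>2"
    unfolding power_mult_distrib sq by (simp only: mult_ac)
  finally have "2 * N * (a * b * (a + b))\<^sup>2 \<le> M" .
  hence "M * (2 * N * (a * b * (a + b))\<^sup>2) \<le> M * M"
    using pos by (intro mult_left_mono) auto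
  hence "sqrt (2 * M * N * (a * b * (a + b))\<^sup>2) \<le> sqrt (M\<^sup>2)"
    by (intro real_sqrt_le_mono) (simp add: power2_eq_square mult_ac)
  hence "sqrt (2 * M * N) * (a * b * (a + b)) \<le> M"
    using pos by (simp add: real_sqrt_mult)
  hence "sqrt (2 * M * N) * (a * b * (a + b)) / (a\<^sup>2 * b\<^sup>2) \<le> M * (a\<^sup>2 - b\<^sup>2) / (a\<^sup>2 * b\<^sup>2)"
    using diff by (intro divide_right_mono) simp_all
  also have "M * (a\<^sup>2 - b\<^sup>2) / (a\<^sup>2 * b\<^sup>2) = M / b\<^sup>2 - M / a\<^sup>2"
    using pos by (simp add: field_simps)
  also have "sqrt (2 * M * N) * (a * b * (a + b)) / (a\<^sup>2 * b\<^sup>2) = sqrt (2 * M * N) / a + sqrt (2 * M * N) / b"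
    by (rule split)
  finally have "M / a\<^sup>2 + sqrt (2 * M * N) / a \<le> M / b\<^sup>2 - sqrt (2 * M * N) / b"
    by simp
  thus ?thesis
    using True sq by (simp add: interval_I'_def M_def a_def b_def mult.assoc)
qed

subsection \<open>Sums of squares\<close>

lemma sum_list_square_nonneg: "(\<Sum>x\<leftarrow>xs. (f x :: real)\<^sup>2) \<ge> 0"
  by (rule sum_list_nonneg) auto

lemma sum_list_Cauchy_Schwarz:
  fixes f g :: "'a \<Rightarrow> real"
  shows "(\<Sum>x\<leftarrow>xs. f x * g x)\<^sup>2 \<le> (\<Sum>x\<leftarrow>xs. (f x)\<^sup>2) * (\<Sum>x\<leftarrow>xs. (g x)\<^sup>2)"
proof (induction xs)
  case Nil
  show ?case by simp
next
  case (Cons x xs)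
  define S F G where "S = (\<Sum>x\<leftarrow>xs. f x * g x)" and "F = (\<Sum>x\<leftarrow>xs. (f x)\<^sup>2)"
    and "G = (\<Sum>x\<leftarrow>xs. (g x)\<^sup>2)"
  have nonneg: "F \<ge> 0" "G \<ge> 0"
    unfolding F_def G_def by (rule sum_list_square_nonneg)+
  have "S\<^sup>2 \<le> F * G"
    using Cons.IH by (simp add: S_def F_def G_def)
  hence "\<bar>S\<bar> \<le> sqrt F * sqrt G"
    by (metis real_sqrt_abs real_sqrt_le_iff real_sqrt_mult)
  \<comment> \<open>The cross term created by the new entry is controlled by the inequality of
    arithmetic and geometric means.\<close>
  hence "2 * \<bar>f x * g x\<bar> * \<bar>S\<bar> \<le> 2 * \<bar>f x * g x\<bar> * (sqrt F * sqrt G)"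
    by (intro mult_left_mono) auto
  also have "\<dots> = 2 * (\<bar>f x\<bar> * sqrt G) * (\<bar>g x\<bar> * sqrt F)"
    by (simp add: abs_mult)
  also have "\<dots> \<le> (\<bar>f x\<bar> * sqrt G)\<^sup>2 + (\<bar>g x\<bar> * sqrt F)\<^sup>2"
    by (rule sum_squares_bound)
  also have "\<dots> = (f x)\<^sup>2 * G + (g x)\<^sup>2 * F"
    using nonneg by (simp add: power_mult_distrib)
  finally have "2 * (f x * g x) * S \<le> (f x)\<^sup>2 * G + (g x)\<^sup>2 * F"
    using abs_ge_self[of "f x * g x * S"] by (simp add: abs_mult)
  hence "(f x * g x + S)\<^sup>2 \<le> ((f x)\<^sup>2 + F) * ((g x)\<^sup>2 + G)"
    using \<open>S\<^sup>2 \<le> F * G\<close> by (simp add: power2_sum power_mult_distrib algebra_simps)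
  thus ?case
    by (simp add: S_def F_def G_def)
qed

section \<open>Coordinates of a sum of squares\<close>

context biquadratic
begin

lemma sum_squares_coords:
  "(\<Sum>x\<leftarrow>xs. (Quad (a x) (b x) (c x) (d x))\<^sup>2) =
    Quad (\<Sum>x\<leftarrow>xs. (a x)\<^sup>2 + real p * (b x)\<^sup>2 + real q * (c x)\<^sup>2 + real p * real q * (d x)\<^sup>2)
      (\<Sum>x\<leftarrow>xs. 2 * (a x * b x + real q * (c x * d x)))
      (\<Sum>x\<leftarrow>xs. 2 * (a x * c x + real p * (b x * d x)))
      (\<Sum>x\<leftarrow>xs. 2 * (a x * d x + b x * c x))"
proof (induction xs)
  case Nil
  show ?case by (simp add: quad_def)
next
  case (Cons x xs)
  have "(Quad (a x) (b x) (c x) (d x))\<^sup>2 =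
    Quad ((a x)\<^sup>2 + real p * (b x)\<^sup>2 + real q * (c x)\<^sup>2 + real p * real q * (d x)\<^sup>2)
      (2 * (a x * b x + real q * (c x * d x))) (2 * (a x * c x + real p * (b x * d x)))
      (2 * (a x * d x + b x * c x))"
    unfolding power2_eq_square
    by (subst quad_mult[of _ "real p" _ "real q"]) (auto simp: algebra_simps power2_eq_square)
  thus ?case
    using Cons.IH by (simp add: quad_add)
qed

lemma sum_list_Rats: "(\<And>x. x \<in> set xs \<Longrightarrow> f x \<in> \<rat>) \<Longrightarrow> (\<Sum>x\<leftarrow>xs. f x) \<in> (\<rat> :: real set)"
  by (induction xs) auto

text \<open>The assumption on the size of \<open>2Mc\<close> keeps the summands from involving \<open>\<surd>r\<close>. Their coefficients
  at \<open>\<surd>p\<close> are then integers, and \<open>B\<close> is the sum of the squares of these.\<close>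

lemma sum_squares_bound_coeffs:
  assumes p: "squarefree p" "p mod 4 = 2" and q: "squarefree q" "odd q"
    and r: "p * q = r * g\<^sup>2" "squarefree r"
    and "M \<in> \<rat>" "c \<in> \<rat>" "M > 0"
    and small: "2 * M * c < real r / 4"
    and mem: "2 * M * (c + sqrt (real p)) \<in> sums_of_squares (ring_of_integers (biquadratic_field p q))"
  obtains B :: nat where "B > 0" "real p * (real B)\<^sup>2 + M\<^sup>2 \<le> 2 * M * c * real B"
proof -
  obtain xs where xs: "set xs \<subseteq> ring_of_integers (biquadratic_field p q)"
    and sum: "2 * M * (c + sqrt (real p)) = (\<Sum>x\<leftarrow>xs. x\<^sup>2)"
    using mem by (auto simp: sums_of_squares_def)
  have "\<forall>x\<in>set xs. \<exists>e f h k. e \<in> \<rat> \<and> f \<in> \<rat> \<and> h \<in> \<rat> \<and> k \<in> \<rat> \<and> x = Quad e f h k"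
  proof
    fix x
    assume "x \<in> set xs"
    hence "x \<in> span"
      using xs biquadratic_field_subset_span unfolding ring_of_integers_def by blast
    thus "\<exists>e f h k. e \<in> \<rat> \<and> f \<in> \<rat> \<and> h \<in> \<rat> \<and> k \<in> \<rat> \<and> x = Quad e f h k"
      by (elim span_E) blast
  qed
  then obtain e f h k where efhk: "\<And>x. x \<in> set xs \<Longrightarrow>
      e x \<in> \<rat> \<and> f x \<in> \<rat> \<and> h x \<in> \<rat> \<and> k x \<in> \<rat> \<and> x = Quad (e x) (f x) (h x) (k x)"
    by metis
  have "(\<Sum>x\<leftarrow>xs. x\<^sup>2) = (\<Sum>x\<leftarrow>xs. (Quad (e x) (f x) (h x) (k x))\<^sup>2)"
    by (intro arg_cong[of _ _ sum_list] map_cong) (use efhk in auto)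
  hence "Quad (2 * M * c) (2 * M) 0 0 =
    Quad (\<Sum>x\<leftarrow>xs. (e x)\<^sup>2 + real p * (f x)\<^sup>2 + real q * (h x)\<^sup>2 + real p * real q * (k x)\<^sup>2)
      (\<Sum>x\<leftarrow>xs. 2 * (e x * f x + real q * (h x * k x)))
      (\<Sum>x\<leftarrow>xs. 2 * (e x * h x + real p * (f x * k x)))
      (\<Sum>x\<leftarrow>xs. 2 * (e x * k x + f x * h x))"
    using sum by (simp add: sum_squares_coords) (simp add: quad_def algebra_simps)
  hence "2 * M * c = (\<Sum>x\<leftarrow>xs. (e x)\<^sup>2 + real p * (f x)\<^sup>2 + real q * (h x)\<^sup>2 + real p * real q * (k x)\<^sup>2)
      \<and> 2 * M = (\<Sum>x\<leftarrow>xs. 2 * (e x * f x + real q * (h x * k x)))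
      \<and> 0 = (\<Sum>x\<leftarrow>xs. 2 * (e x * h x + real p * (f x * k x)))
      \<and> 0 = (\<Sum>x\<leftarrow>xs. 2 * (e x * k x + f x * h x))"
    by (intro Quad_inject) (use efhk assms in \<open>auto intro!: sum_list_Rats Rats_add Rats_mult\<close>)
  hence trace: "2 * M * c = (\<Sum>x\<leftarrow>xs. (e x)\<^sup>2 + real p * (f x)\<^sup>2 + real q * (h x)\<^sup>2 + real p * real q * (k x)\<^sup>2)"
    and M: "2 * M = (\<Sum>x\<leftarrow>xs. 2 * (e x * f x + real q * (h x * k x)))"
    by blast+
  have coords: "2 * (real g * k x) \<in> \<int>" "k x = 0 \<Longrightarrow> f x \<in> \<int>" if "x \<in> set xs" for x
  proof -
    have "algebraic_int (Quad (e x) (f x) (h x) (k x))"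
      using that xs efhk by (auto simp: ring_of_integers_def)
    thus "2 * (real g * k x) \<in> \<int>" "k x = 0 \<Longrightarrow> f x \<in> \<int>"
      using algebraic_int_coords[OF _ _ _ _ _ p q r] efhk[OF that] by blast+
  qed
  have pq: "real p * real q = real r * (real g)\<^sup>2"
    using r(1) by (metis of_nat_mult of_nat_power)
  \<comment> \<open>Otherwise 2 g k(x) is a nonzero integer, and p q k(x)^2 = r (g k(x))^2 >= r/4
    exceeds the whole rational part.\<close>
  have k0: "k x = 0" if x: "x \<in> set xs" for x
  proof (rule ccontr)
    assume "k x \<noteq> 0"
    moreover have "g > 0"
      using pq p q by (intro Nat.gr0I) auto
    ultimately have nz: "2 * (real g * k x) \<noteq> 0"
      by simp
    obtain i where i: "2 * (real g * k x) = of_int i"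
      using coords(1)[OF x] by (elim Ints_cases)
    hence "i \<noteq> 0"
      using nz by auto
    hence "1 \<le> i\<^sup>2"
      by (simp add: int_one_le_iff_zero_less)
    hence "1 \<le> (2 * (real g * k x))\<^sup>2"
      unfolding i by (metis of_int_1_le_iff of_int_power)
    hence "real r * 1 \<le> real r * (2 * (real g * k x))\<^sup>2"
      by (intro mult_left_mono) auto
    also have "\<dots> = 4 * (real p * real q * (k x)\<^sup>2)"
      unfolding pq by (simp add: power_mult_distrib)
    finally have "real r / 4 \<le> real p * real q * (k x)\<^sup>2"
      by simp
    also have "\<dots> \<le> (e x)\<^sup>2 + real p * (f x)\<^sup>2 + real q * (h x)\<^sup>2 + real p * real q * (k x)\<^sup>2"
      by simp
    also have "\<dots> \<le> 2 * M * c"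
      unfolding trace using x by (intro member_le_sum_list) auto
    finally show False
      using small by simp
  qed
  have "(\<Sum>x\<leftarrow>xs. (f x)\<^sup>2) \<in> \<int>"
    using k0 coords(2) by (induction xs) auto
  then obtain B' where B': "(\<Sum>x\<leftarrow>xs. (f x)\<^sup>2) = of_int B'"
    by (elim Ints_cases)
  moreover have "(\<Sum>x\<leftarrow>xs. (f x)\<^sup>2) \<ge> 0"
    by (rule sum_list_square_nonneg)
  ultimately have B: "(\<Sum>x\<leftarrow>xs. (f x)\<^sup>2) = real (nat B')"
    by simp
  have "2 * M = (\<Sum>x\<leftarrow>xs. 2 * (e x * f x))"
    unfolding M by (intro arg_cong[of _ _ sum_list] map_cong) (use k0 in auto)
  hence "M = (\<Sum>x\<leftarrow>xs. e x * f x)"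
    by (simp add: sum_list_const_mult)
  hence cs: "M\<^sup>2 \<le> (\<Sum>x\<leftarrow>xs. (e x)\<^sup>2) * real (nat B')"
    using sum_list_Cauchy_Schwarz[of e f xs] B by simp
  \<comment> \<open>By Cauchy-Schwarz, B = 0 would force M = 0.\<close>
  have "nat B' > 0"
  proof (rule ccontr)
    assume "\<not> nat B' > 0"
    hence "M\<^sup>2 \<le> 0"
      using cs by simp
    thus False
      using assms by simp
  qed
  moreover have "real p * (real (nat B'))\<^sup>2 + M\<^sup>2 \<le> 2 * M * c * real (nat B')"
  proof -
    \<comment> \<open>Dropping the other nonnegative terms of the rational part leaves the sum of
      e^2 plus p B, at most 2Mc. Multiplying by B brings in \<open>cs\<close>.\<close>
    have "(\<Sum>x\<leftarrow>xs. (e x)\<^sup>2) + real p * (\<Sum>x\<leftarrow>xs. (f x)\<^sup>2) = (\<Sum>x\<leftarrow>xs. (e x)\<^sup>2 + real p * (f x)\<^sup>2)"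
      by (simp add: sum_list_addf sum_list_const_mult)
    also have "\<dots> \<le> 2 * M * c"
      unfolding trace by (intro sum_list_mono) auto
    finally have "(\<Sum>x\<leftarrow>xs. (e x)\<^sup>2) + real p * real (nat B') \<le> 2 * M * c"
      using B by simp
    hence "((\<Sum>x\<leftarrow>xs. (e x)\<^sup>2) + real p * real (nat B')) * real (nat B') \<le> 2 * M * c * real (nat B')"
      by (intro mult_right_mono) auto
    thus ?thesis
      using cs by (simp add: power2_eq_square algebra_simps)
  qed
  ultimately show ?thesis
    using that by blast
qed

end

subsection \<open>The totally positive element\<close>

lemma real_embeddings_apply:
  assumes "\<sigma> \<in> real_embeddings K"
  shows "\<sigma> 1 = 1" "x \<in> K \<Longrightarrow> y \<in> K \<Longrightarrow> \<sigma> (x + y) = \<sigma> x + \<sigma> y" "x \<in> K \<Longrightarrow> y \<in> K \<Longrightarrow> \<sigma> (x * y) = \<sigma> x * \<sigma> y"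
  using assms by (auto simp: real_embeddings_def ring_hom_def ring_of_type_algebra_def)

lemma biquadratic_field_closed:
  "1 \<in> biquadratic_field p q" "sqrt (real p) \<in> biquadratic_field p q"
  "x \<in> biquadratic_field p q \<Longrightarrow> y \<in> biquadratic_field p q \<Longrightarrow> x + y \<in> biquadratic_field p q"
  "x \<in> biquadratic_field p q \<Longrightarrow> y \<in> biquadratic_field p q \<Longrightarrow> x * y \<in> biquadratic_field p q"
  using generate_field.one[of real_ring "{sqrt (real p), sqrt (real q)}"]
    generate_field.incl[of "sqrt (real p)" "{sqrt (real p), sqrt (real q)}" real_ring]
    generate_field.eng_add[of x real_ring "{sqrt (real p), sqrt (real q)}" y]
    generate_field.eng_mult[of x real_ring "{sqrt (real p), sqrt (real q)}" y]
  by (auto simp: biquadratic_field_def ring_of_type_algebra_def)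

text \<open>Starting the induction at 1 reduces the claim to the unit and closure under
  addition.\<close>

lemma of_nat_Suc_in_biquadratic_field: "real (Suc n) \<in> biquadratic_field p q"
proof (induction n)
  case (Suc n)
  thus ?case
    using biquadratic_field_closed(3)[OF biquadratic_field_closed(1) Suc.IH] by simp
qed (simp add: biquadratic_field_closed)

lemma real_embeddings_of_nat_Suc:
  assumes "\<sigma> \<in> real_embeddings (biquadratic_field p q)"
  shows "\<sigma> (real (Suc n)) = real (Suc n)"
proof (induction n)
  case (Suc n)
  have "\<sigma> (1 + real (Suc n)) = \<sigma> 1 + \<sigma> (real (Suc n))"
    by (intro real_embeddings_apply[OF assms] biquadratic_field_closed of_nat_Suc_in_biquadratic_field)
  thus ?case
    using Suc.IH real_embeddings_apply(1)[OF assms] by simp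
qed (use real_embeddings_apply(1)[OF assms] in simp)

text \<open>An embedding sends sqrt(p) to a square root of p, so the possible values are k (c +
  sqrt(p)) and k (c - sqrt(p)), both positive.\<close>

lemma totally_positive_quadratic:
  fixes p q k c :: nat
  assumes "p > 0" "k > 0" "sqrt (real p) < real c"
  shows "real k * (real c + sqrt (real p)) \<in> totally_positive_integers (biquadratic_field p q)"
proof -
  let ?K = "biquadratic_field p q"
  have "c > 0"
    using assms by (intro Nat.gr0I) auto
  have nat_mem: "real n \<in> ?K" if "n > 0" for n
    using that of_nat_Suc_in_biquadratic_field[of "n - 1" p q] by simp
  have mem: "real c + sqrt (real p) \<in> ?K"
    using nat_mem \<open>c > 0\<close> by (intro biquadratic_field_closed) auto
  have "\<sigma> (real k * (real c + sqrt (real p))) > 0" if \<sigma>: "\<sigma> \<in> real_embeddings ?K" for \<sigma>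
  proof -
    have nat: "\<sigma> (real n) = real n" if "n > 0" for n
      using that real_embeddings_of_nat_Suc[OF \<sigma>, of "n - 1"] by simp
    have "\<sigma> (sqrt (real p)) * \<sigma> (sqrt (real p)) = \<sigma> (sqrt (real p) * sqrt (real p))"
      by (intro real_embeddings_apply(3)[OF \<sigma>, symmetric] biquadratic_field_closed)
    hence "(\<sigma> (sqrt (real p)))\<^sup>2 = real p"
      using nat assms by (simp add: power2_eq_square)
    hence "\<bar>\<sigma> (sqrt (real p))\<bar> = sqrt (real p)"
      by (metis real_sqrt_abs)
    moreover have "\<sigma> (real k * (real c + sqrt (real p))) = real k * (real c + \<sigma> (sqrt (real p)))"
      using real_embeddings_apply(2,3)[OF \<sigma>] nat nat_mem mem \<open>c > 0\<close> assms biquadratic_field_closed(2)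
      by simp
    moreover from calculation have "real c + \<sigma> (sqrt (real p)) > 0"
      using assms by linarith
    ultimately show ?thesis
      using assms by simp
  qed
  moreover have "algebraic_int (real k * (real c + sqrt (real p)))"
  proof (rule algebraic_int.intros)
    \<comment> \<open>The product of X - k (c + sqrt(p)) and X - k (c - sqrt(p)).\<close>
    let ?f = "[:(real k)\<^sup>2 * ((real c)\<^sup>2 - real p), - 2 * real k * real c, 1:]"
    show "lead_coeff ?f = 1"
      by simp
    show "\<forall>i. coeff ?f i \<in> \<int>"
      by (auto simp: coeff_pCons split: nat.splits)
    show "poly ?f (real k * (real c + sqrt (real p))) = 0"
      by (simp add: algebra_simps power2_eq_square)
  qed
  moreover have "real k * (real c + sqrt (real p)) \<in> ?K"
    using nat_mem assms mem by (intro biquadratic_field_closed(4)) auto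
  ultimately show ?thesis
    by (auto simp: totally_positive_integers_def ring_of_integers_def)
qed

section \<open>The witness, the size estimate and the non-emptiness of the intervals\<close>

theorem proposition3p2:
  fixes p q r m t1 t2 \<kappa> :: nat and K :: "real set" and N1 N2 :: real
  assumes "p \<ge> 2" and "q \<ge> 2" and "squarefree p" and "squarefree q"
    and "p mod 4 = 2" and "q mod 4 = 3"
    and "r = p * q div (gcd p q)\<^sup>2"
    and "p < q" and "q < r"
    and "K = biquadratic_field p q"
    and "sqrt (real p) + sqrt (real q) + 1 > real_of_int \<lceil>sqrt (real r)\<rceil>"
    and "m > 0" and "t1 > 0" and "t2 > 0" and "\<kappa> > 0"
    and "real m < real r / (16 * real \<kappa> * real_of_int \<lceil>sqrt (real r)\<rceil>)"
    and "N1 = real_of_int (max \<lceil>2 * sqrt (real q) - sqrt (real p)\<rceil>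
                               \<lceil>sqrt (real r) - sqrt (real p)\<rceil>) - sqrt (real p)"
    and "N2 = real_of_int (max \<lceil>2 * sqrt (real p) - sqrt (real q)\<rceil>
                               \<lceil>sqrt (real r) - sqrt (real q)\<rceil>) - sqrt (real q)"
    and "N1 \<ge> 0" and "N2 \<ge> 0"
  shows "(sqrt (real p) \<in> interval_I' m \<kappa> N1 t1 \<and> sqrt (real q) \<in> interval_I' m \<kappa> N2 t2 \<longrightarrow>
            \<not> (\<lambda>\<alpha>. real m * \<alpha>) ` totally_positive_integers K
                \<subseteq> sums_of_squares (ring_of_integers K)) \<and>
         (real m \<ge> max
            (2 * N1 * real t1 * (real t1 - 1) *
               (2 * real t1 - 1 + 2 * sqrt (real t1 * (real t1 - 1))) / real \<kappa>)
            (2 * N2 * real t2 * (real t2 - 1) *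
               (2 * real t2 - 1 + 2 * sqrt (real t2 * (real t2 - 1))) / real \<kappa>) \<longrightarrow>
            interval_I' m \<kappa> N1 t1 \<noteq> {} \<and> interval_I' m \<kappa> N2 t2 \<noteq> {})"
proof (intro conjI impI)
  assume mem: "sqrt (real p) \<in> interval_I' m \<kappa> N1 t1 \<and> sqrt (real q) \<in> interval_I' m \<kappa> N2 t2"
  define g where "g = gcd p q"
  have "g > 0"
    using assms by (simp add: g_def)
  \<comment> \<open>Splitting off the gcd gives r = p' q' with coprime square-free factors, so r is
    square-free and p q = r g^2.\<close>
  obtain p' q' where pq': "p = g * p'" "q = g * q'" "coprime p' q'"
    unfolding g_def using assms by (metis gcd_coprime_exists gcd_eq_0_iff mult.commute not_numeral_le_zero)
  have "p * q = (p' * q') * g\<^sup>2"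
    by (simp add: pq' power2_eq_square mult_ac)
  hence r: "r = p' * q'"
    using \<open>g > 0\<close> assms(7) by (simp flip: g_def)
  hence pqr: "p * q = r * g\<^sup>2"
    using \<open>p * q = (p' * q') * g\<^sup>2\<close> by simp
  have "squarefree p'" "squarefree q'"
    using assms(3,4) squarefree_mono pq' by (metis dvd_triv_right)+
  hence sf_r: "squarefree r"
    unfolding r using pq'(3) by (simp add: squarefree_mult_coprime)
  have "odd q"
    using assms(6) by presburger
  interpret biquadratic p q
  proof
    show "sqrt (real p) \<notin> \<rat>" "sqrt (real q) \<notin> \<rat>"
      using assms sqrt_squarefree_irrational by blast+
    show "sqrt (real p) * sqrt (real q) \<notin> \<rat>"
    proof
      assume "sqrt (real p) * sqrt (real q) \<in> \<rat>"
      moreover have "sqrt (real p) * sqrt (real q) = sqrt (real r) * real g"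
        using pqr by (metis of_nat_0_le_iff of_nat_mult of_nat_power real_sqrt_abs2 real_sqrt_mult
            real_sqrt_unique)
      ultimately have "sqrt (real r) * real g / real g \<in> \<rat>"
        by (metis Rats_divide Rats_of_nat)
      hence "sqrt (real r) \<in> \<rat>"
        using \<open>g > 0\<close> by simp
      thus False
        using sqrt_squarefree_irrational[OF sf_r] assms by simp
    qed
  qed
  define c where "c = N1 + sqrt (real p)"
  have c_eq: "c = real_of_int (max \<lceil>2 * sqrt (real q) - sqrt (real p)\<rceil> \<lceil>sqrt (real r) - sqrt (real p)\<rceil>)"
    using assms(17) by (simp add: c_def)
  have cI: "c \<in> \<int>"
    unfolding c_eq by simp
  \<comment> \<open>An integer differs from the irrational sqrt(p), so N1 >= 0 becomes strict, as
    total positivity demands.\<close>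
  have "c \<noteq> sqrt (real p)"
    using irrational(1) cI Ints_subset_Rats by auto
  hence c_gt: "sqrt (real p) < c"
    using assms(19) by (simp add: c_def)
  obtain n where n: "c = real n"
  proof -
    obtain i where i: "c = of_int i"
      using cI by (elim Ints_cases)
    have "0 < c"
      using c_gt by (rule le_less_trans[rotated]) simp
    thus ?thesis
      using that[of "nat i"] i by simp
  qed
  \<comment> \<open>The factor 2 \<kappa> makes m times the witness equal to 2M (c + sqrt(p)) with M
    = m \<kappa>.\<close>
  have tp: "real (2 * \<kappa>) * (c + sqrt (real p)) \<in> totally_positive_integers K"
    unfolding n \<open>K = biquadratic_field p q\<close>
    using \<open>p \<ge> 2\<close> \<open>\<kappa> > 0\<close> c_gt[unfolded n] by (intro totally_positive_quadratic) simp_all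
  \<comment> \<open>Both quantities in the maximum are at most 2 sqrt(r) before rounding, because q
    < r.\<close>
  have c_le: "c \<le> 2 * of_int \<lceil>sqrt (real r)\<rceil>"
  proof -
    have "sqrt (real q) \<le> sqrt (real r)" "sqrt (real p) \<ge> 0" "sqrt (real r) \<ge> 0"
      using assms by auto
    moreover have "sqrt (real r) \<le> of_int \<lceil>sqrt (real r)\<rceil>"
      by (rule le_of_int_ceiling)
    ultimately have "\<lceil>2 * sqrt (real q) - sqrt (real p)\<rceil> \<le> 2 * \<lceil>sqrt (real r)\<rceil>"
        "\<lceil>sqrt (real r) - sqrt (real p)\<rceil> \<le> 2 * \<lceil>sqrt (real r)\<rceil>"
      unfolding ceiling_le_iff of_int_mult of_int_numeral by linarith+
    hence "max \<lceil>2 * sqrt (real q) - sqrt (real p)\<rceil> \<lceil>sqrt (real r) - sqrt (real p)\<rceil> \<le> 2 * \<lceil>sqrt (real r)\<rceil>"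
      by simp
    thus ?thesis
      unfolding c_eq by linarith
  qed
  have "r > 0"
    using assms by simp
  hence ceil: "real_of_int \<lceil>sqrt (real r)\<rceil> > 0"
    by simp
  \<comment> \<open>The 16 in the bound on m is composed of the 2 in 2M, the 2 in the estimate of c
    and the 4 in r/4.\<close>
  have "2 * (real m * real \<kappa>) * c \<le> 2 * (real m * real \<kappa>) * (2 * of_int \<lceil>sqrt (real r)\<rceil>)"
    using c_le by (intro mult_left_mono) auto
  also have "\<dots> < real r / 4"
    using assms(15,16) ceil by (simp add: pos_less_divide_eq mult_ac)
  finally have small: "2 * (real m * real \<kappa>) * c < real r / 4" .
  show "\<not> (\<lambda>\<alpha>. real m * \<alpha>) ` totally_positive_integers K \<subseteq> sums_of_squares (ring_of_integers K)"
  proof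
    assume "(\<lambda>\<alpha>. real m * \<alpha>) ` totally_positive_integers K \<subseteq> sums_of_squares (ring_of_integers K)"
    hence "real m * (real (2 * \<kappa>) * (c + sqrt (real p))) \<in> sums_of_squares (ring_of_integers K)"
      using tp by blast
    hence "2 * (real m * real \<kappa>) * (c + sqrt (real p))
        \<in> sums_of_squares (ring_of_integers (biquadratic_field p q))"
      using assms(10) by (simp add: mult_ac)
    moreover have "real m * real \<kappa> \<in> \<rat>" "c \<in> \<rat>" "real m * real \<kappa> > 0"
      using assms n by auto
    ultimately obtain B where B: "B > 0"
      "real p * (real B)\<^sup>2 + (real m * real \<kappa>)\<^sup>2 \<le> 2 * (real m * real \<kappa>) * c * real B"
      using sum_squares_bound_coeffs[OF assms(3,5,4) \<open>odd q\<close> pqr sf_r _ _ _ small] by metis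
    hence "sqrt (real p) \<notin> interval_I' m \<kappa> (c - sqrt (real p)) t1"
      using \<open>m > 0\<close> \<open>\<kappa> > 0\<close> \<open>t1 > 0\<close> \<open>p mod 4 = 2\<close> cI c_gt by (intro not_in_interval_I'[OF _ _ B(1) _ _ _ _ B(2)]) auto
    thus False
      using mem by (simp add: c_def)
  qed
next
  assume le: "real m \<ge> max
      (2 * N1 * real t1 * (real t1 - 1) *
         (2 * real t1 - 1 + 2 * sqrt (real t1 * (real t1 - 1))) / real \<kappa>)
      (2 * N2 * real t2 * (real t2 - 1) *
         (2 * real t2 - 1 + 2 * sqrt (real t2 * (real t2 - 1))) / real \<kappa>)"
  show "interval_I' m \<kappa> N1 t1 \<noteq> {}"
    by (rule interval_I'_nonempty[OF \<open>m > 0\<close> \<open>\<kappa> > 0\<close> \<open>t1 > 0\<close> \<open>N1 \<ge> 0\<close> order_trans[OF max.cobounded1 le]])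
  show "interval_I' m \<kappa> N2 t2 \<noteq> {}"
    by (rule interval_I'_nonempty[OF \<open>m > 0\<close> \<open>\<kappa> > 0\<close> \<open>t2 > 0\<close> \<open>N2 \<ge> 0\<close> order_trans[OF max.cobounded2 le]])
qed

end
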